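(* Let $G$ be a finite interval graph and let $I^*$ be a maximum independent set of $G$. Then every independent set $S$ that can be returned by \textsc{Greedy} on $G$ (for any way of breaking ties) satisfies $|S| \geq \frac{2}{3}|I^*|$.
   Context: All graphs are finite, simple and undirected. A graph is an interval graph if its vertices can be represented by closed intervals of the real line so that two vertices are adjacent if and only if their intervals intersect. For a vertex $v$, $N[v]$ is its closed neighbourhood, $d(v)$ its degree, and $\delta(G)$ the minimum degree. The minimum-degree greedy algorithm \textsc{Greedy}: start with $S=\emptyset$; while the current graph $G$ is nonempty, choose any vertex $v$ with $d(v)=\delta(G)$ (ties broken arbitrarily/adversarially), add $v$ to $S$, and replace $G$ by $G\setminus N[v]$. A solution "can be returned by \textsc{Greedy}" if it is the output for some sequence of tie-breaking choices. *)

theory Defs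
  imports Complex_Main "Graph_Theory.Digraph_Component"
begin

text \<open>
  A finite simple undirected graph is a \<^locale>\<open>graph\<close>: a finite loop-free digraph without
  parallel arcs whose arc relation is symmetric. An undirected edge is thus a pair of opposite
  arcs, and the degree of a vertex is its \<^const>\<open>out_degree\<close>.
\<close>

definition interval_graph :: "('a, 'b) pre_digraph \<Rightarrow> bool" where
  "interval_graph G \<longleftrightarrow> graph G \<and>
     (\<exists>l r :: 'a \<Rightarrow> real.
        (\<forall>v \<in> verts G. l v \<le> r v) \<and>
        (\<forall>u \<in> verts G. \<forall>v \<in> verts G. u \<noteq> v \<longrightarrow>
           (u \<rightarrow>\<^bsub>G\<^esub> v \<longleftrightarrow> {l u..r u} \<inter> {l v..r v} \<noteq> {})))"

definition independent_set :: "('a, 'b) pre_digraph \<Rightarrow> 'a set \<Rightarrow> bool" where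
  "independent_set G I \<longleftrightarrow> I \<subseteq> verts G \<and> (\<forall>u \<in> I. \<forall>v \<in> I. \<not> u \<rightarrow>\<^bsub>G\<^esub> v)"

definition maximum_independent_set :: "('a, 'b) pre_digraph \<Rightarrow> 'a set \<Rightarrow> bool" where
  "maximum_independent_set G I \<longleftrightarrow>
     independent_set G I \<and> (\<forall>J. independent_set G J \<longrightarrow> card J \<le> card I)"

definition closed_neighbourhood :: "('a, 'b) pre_digraph \<Rightarrow> 'a \<Rightarrow> 'a set" where
  "closed_neighbourhood G v = insert v {u. v \<rightarrow>\<^bsub>G\<^esub> u}"

definition min_degree :: "('a, 'b) pre_digraph \<Rightarrow> nat" where
  "min_degree G = Min (out_degree G ` verts G)"

text \<open>
  \<open>greedy G S\<close>: some sequence of tie-breaking choices makes the minimum-degree greedy algorithm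
  return \<open>S\<close> on input \<open>G\<close>.
\<close>

inductive greedy :: "('a, 'b) pre_digraph \<Rightarrow> 'a set \<Rightarrow> bool" where
  greedy_empty: "verts G = {} \<Longrightarrow> greedy G {}"
| greedy_step: "v \<in> verts G \<Longrightarrow> out_degree G v = min_degree G \<Longrightarrow>
    greedy (G \<restriction> (verts G - closed_neighbourhood G v)) S \<Longrightarrow> greedy G (insert v S)"

end

theory Submission
  imports Defs
begin

text \<open>
  Track the number \<open>c\<close> of connected components. A vertex \<open>v\<close> of minimum degree has at most two
  pairwise non-adjacent neighbours, since the middle one of three would have smaller degree. If
  \<open>N[v]\<close> contains two vertices \<open>a\<close>, \<open>b\<close> of an independent set, then \<open>a\<close> and \<open>b\<close> have degree at
  least \<open>d(v)\<close> and hence have neighbours that miss \<open>v\<close>, one on either side of \<open>v\<close>; so removing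
  \<open>N[v]\<close> splits a component and \<open>c\<close> grows. Every other step decreases \<open>c\<close> by at most one. Hence
  \<open>2 |I| + c \<le> 3 |S|\<close> is maintained for every independent set \<open>I\<close>.
\<close>

section \<open>Interval families and the number of their components\<close>

locale interval_family =
  fixes V :: "'a set" and l r :: "'a \<Rightarrow> real"
  assumes finite_V: "finite V"
    and l_le_r: "v \<in> V \<Longrightarrow> l v \<le> r v"
begin

text \<open>Closed: for \<open>v\<close> in \<open>V\<close> it contains \<open>v\<close> itself, so
  comparing degrees amounts to comparing the cardinalities of these sets.\<close>

definition nbhd :: "'a \<Rightarrow> 'a set" where
  "nbhd v = {u \<in> V. l u \<le> r v \<and> l v \<le> r u}"

text \<open>One left endpoint for every connected component of the union of the intervals.\<close>

definition component_starts :: "'a set \<Rightarrow> real set" where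
  "component_starts W = {x \<in> l ` W. \<forall>u \<in> W. l u < x \<longrightarrow> r u < x}"

definition pairwise_disjoint :: "'a set \<Rightarrow> bool" where
  "pairwise_disjoint I \<longleftrightarrow> (\<forall>u \<in> I. \<forall>v \<in> I. u \<noteq> v \<longrightarrow> r u < l v \<or> r v < l u)"

lemma finite_component_starts: "W \<subseteq> V \<Longrightarrow> finite (component_starts W)"
  unfolding component_starts_def using finite_V finite_subset by fastforce

lemma finite_nbhd: "finite (nbhd v)"
  unfolding nbhd_def using finite_V by simp

lemma exists_minimal_start:
  assumes "w \<in> V" "P w"
  shows "\<exists>w \<in> V. P w \<and> (\<forall>u \<in> V. P u \<longrightarrow> l w \<le> l u)"
proof -
  have "finite {w \<in> V. P w}" "{w \<in> V. P w} \<noteq> {}" using assms finite_V by auto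
  from ex_min_if_finite[OF finite_imageI[OF this(1)], of l] this(2) show ?thesis
    by (fastforce simp: not_less)
qed

text \<open>A lost start is the left endpoint of an interval that meets \<open>v\<close>, so it can
  only be the start of the component containing \<open>v\<close>.\<close>

lemma lost_starts_unique:
  assumes v: "v \<in> V"
    and x: "x \<in> component_starts V" "x \<notin> component_starts (V - nbhd v)"
    and y: "y \<in> component_starts V" "y \<notin> component_starts (V - nbhd v)"
  shows "x = y"
proof -
  have lost: "\<exists>w \<in> nbhd v. l w = z"
    if "z \<in> component_starts V" "z \<notin> component_starts (V - nbhd v)" for z
    using that unfolding component_starts_def by auto
  have no_less: False if "p < q"
    and p: "p \<in> component_starts V" "p \<notin> component_starts (V - nbhd v)"
    and q: "q \<in> component_starts V" "q \<notin> component_starts (V - nbhd v)" for p q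
  proof -
    obtain a b where a: "a \<in> nbhd v" "l a = p" and b: "b \<in> nbhd v" "l b = q"
      using lost[OF p] lost[OF q] by blast
    have "r a < q"
      using a q(1) \<open>p < q\<close> unfolding component_starts_def nbhd_def by auto
    then have "l v < q" using a unfolding nbhd_def by auto
    then have "r v < q" using v q(1) unfolding component_starts_def by auto
    then show False using b unfolding nbhd_def by auto
  qed
  show ?thesis using no_less[OF _ x y] no_less[OF _ y x] by fastforce
qed

lemma card_component_starts_remove:
  assumes v: "v \<in> V"
  shows "card (component_starts V) \<le> card (component_starts (V - nbhd v)) + 1"
proof -
  let ?C = "component_starts V" and ?C' = "component_starts (V - nbhd v)"
  have fin: "finite ?C" "finite ?C'" by (simp_all add: finite_component_starts)
  have "card (?C - ?C') \<le> 1"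
    using lost_starts_unique[OF v] fin card_le_Suc0_iff_eq[of "?C - ?C'"] by auto
  moreover have "card ?C \<le> card (?C' \<union> (?C - ?C'))"
    using fin by (intro card_mono) auto
  ultimately show ?thesis using card_Un_le[of ?C' "?C - ?C'"] by linarith
qed

text \<open>\<open>x\<close> lies left of \<open>v\<close> and \<open>y\<close> right of it. A new
  component begins on the right, at a point covered by \<open>b\<close>. If the start of the
  component of \<open>v\<close> is lost, another new one on the left makes up for it.\<close>

lemma card_component_starts_split:
  assumes v: "v \<in> V"
    and a: "a \<in> nbhd v" and b: "b \<in> nbhd v" and ab: "r a < l b"
    and x: "x \<in> nbhd a" "x \<notin> nbhd v"
    and y: "y \<in> nbhd b" "y \<notin> nbhd v"
  shows "card (component_starts V) + 1 \<le> card (component_starts (V - nbhd v))"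
proof -
  let ?W = "V - nbhd v"
  let ?C = "component_starts V" and ?C' = "component_starts ?W"
  have fin: "finite ?C" "finite ?C'" by (simp_all add: finite_component_starts)
  have V: "a \<in> V" "b \<in> V" "x \<in> ?W" "y \<in> ?W" using a b x y by (auto simp: nbhd_def)
  have lv: "l v \<le> r v" using l_le_r v by blast
  \<comment> \<open>\<open>x\<close> meets \<open>a\<close>, which ends before
    \<open>l b \<le> r v\<close>; as it misses \<open>v\<close>, it lies left of \<open>v\<close>.
    The argument for \<open>y\<close> is symmetric.\<close>
  have xv: "r x < l v" using x a b ab by (auto simp: nbhd_def)
  have yv: "r v < l y" using y a b ab by (auto simp: nbhd_def)
  have side: "r u < l v \<or> r v < l u" if "u \<in> ?W" for u
    using that by (auto simp: nbhd_def)

  obtain y1 where y1: "y1 \<in> ?W" "r v < l y1"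
    and y1_min: "\<And>u. u \<in> ?W \<Longrightarrow> r v < l u \<Longrightarrow> l y1 \<le> l u"
    using exists_minimal_start[of y "\<lambda>u. u \<in> ?W \<and> r v < l u"] V(4) yv by blast
  \<comment> \<open>A remaining interval that starts before \<open>l y1\<close> is not right of
    \<open>v\<close>, so it ends left of \<open>v\<close>.\<close>
  have y1_new: "l y1 \<in> ?C'"
    unfolding component_starts_def using y1 y1_min side lv by fastforce
  \<comment> \<open>\<open>b\<close> meets both \<open>v\<close> and \<open>y\<close>, so it starts
    before \<open>l y1\<close> and reaches it; before the removal no component starts there.\<close>
  have "l b < l y1" using b y1 by (auto simp: nbhd_def)
  moreover have "l y1 \<le> r b" using y1_min[OF V(4) yv] y by (auto simp: nbhd_def)
  ultimately have y1_old: "l y1 \<notin> ?C"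
    using V(2) unfolding component_starts_def by force
  show ?thesis
  proof (cases "?C \<subseteq> ?C'")
    case True
    then have "card (insert (l y1) ?C) \<le> card ?C'"
      using y1_new fin by (intro card_mono) auto
    then show ?thesis using y1_old fin by simp
  next
    case False
    then obtain z where z: "z \<in> ?C" "z \<notin> ?C'" by blast
    then obtain w where w: "w \<in> nbhd v" "l w = z"
      unfolding component_starts_def by auto
    have z_start: "r u < z" if "u \<in> V" "l u < z" for u
      using z(1) that unfolding component_starts_def by blast
    \<comment> \<open>\<open>z\<close> starts the component of \<open>v\<close>: if \<open>a\<close>
      started earlier, then \<open>a\<close>, and hence also \<open>v\<close>, would end before
      \<open>z\<close>, yet \<open>w\<close> starts at \<open>z\<close> and meets
      \<open>v\<close>.\<close>
    have "z \<le> l a"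
    proof (rule ccontr)
      assume "\<not> z \<le> l a"
      then have "r a < z" using z_start[OF V(1)] by simp
      then have "l v < z" using a by (auto simp: nbhd_def)
      then have "r v < z" using z_start[OF v] by simp
      then show False using w by (auto simp: nbhd_def)
    qed
    then have "z \<le> r x" using x by (auto simp: nbhd_def)
    then have zx: "z \<le> l x" using z_start[of x] V(3) by fastforce
    obtain x1 where x1: "x1 \<in> ?W" "z \<le> l x1"
      and x1_min: "\<And>u. u \<in> ?W \<Longrightarrow> z \<le> l u \<Longrightarrow> l x1 \<le> l u"
      using exists_minimal_start[of x "\<lambda>u. u \<in> ?W \<and> z \<le> l u"] V(3) zx by blast
    \<comment> \<open>Intervals that start before \<open>z\<close> also end before \<open>z\<close>,
      and no remaining one starts between \<open>z\<close> and \<open>l x1\<close>.\<close>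
    have x1_new: "l x1 \<in> ?C'"
      unfolding component_starts_def using x1 x1_min z_start by fastforce
    then have "z < l x1" using z(2) x1(2) by (cases "z = l x1") auto
    moreover have x1v: "l x1 < l v"
      using x1_min[OF V(3) zx] l_le_r[of x] V(3) xv by auto
    \<comment> \<open>\<open>w\<close> starts at \<open>z\<close> and reaches \<open>l v\<close>, so
      it covers \<open>l x1\<close>.\<close>
    ultimately have x1_old: "l x1 \<notin> ?C"
      using w unfolding component_starts_def nbhd_def by force
    \<comment> \<open>One start is lost, and two are gained on opposite sides of
      \<open>v\<close>.\<close>
    have "?C - {z} \<subseteq> ?C'" using lost_starts_unique[OF v _ _ z] by blast
    then have "card (insert (l x1) (insert (l y1) (?C - {z}))) \<le> card ?C'"
      using x1_new y1_new fin by (intro card_mono) auto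
    moreover have "l x1 \<noteq> l y1" using x1v y1(2) lv by auto
    ultimately show ?thesis
      using x1_old y1_old fin z(1) by (simp add: card_Suc_Diff1 card_gt_0_iff)
  qed
qed

text \<open>Otherwise \<open>nbhd a\<close> would be a proper subset of \<open>nbhd v\<close>, as it
  misses \<open>b\<close>, and hence smaller.\<close>

lemma exists_nbhd_diff:
  assumes "card (nbhd v) \<le> card (nbhd a)" "b \<in> nbhd v" "b \<notin> nbhd a"
  shows "\<exists>x. x \<in> nbhd a \<and> x \<notin> nbhd v"
proof (rule ccontr)
  assume "\<not> ?thesis"
  then have "nbhd a \<subset> nbhd v" using assms(2,3) by blast
  then have "card (nbhd a) < card (nbhd v)" by (intro psubset_card_mono finite_nbhd)
  then show False using assms(1) by simp
qed

section \<open>Removing the closed neighbourhood of a vertex of minimum degree\<close>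

context
  fixes v
  assumes v: "v \<in> V" and v_min: "\<And>u. u \<in> V \<Longrightarrow> card (nbhd v) \<le> card (nbhd u)"
begin

text \<open>Lying between \<open>a\<close> and \<open>c\<close>, which both meet \<open>v\<close>,
  the interval of \<open>b\<close> is inside that of \<open>v\<close>. So all neighbours of
  \<open>b\<close> meet \<open>v\<close>, while \<open>a\<close> meets \<open>v\<close> but not
  \<open>b\<close>, against minimality.\<close>

lemma no_three_disjoint_neighbours:
  assumes "a \<in> nbhd v" "b \<in> nbhd v" "c \<in> nbhd v" "r a < l b" "r b < l c"
  shows False
proof -
  have "a \<notin> nbhd b" using assms by (auto simp: nbhd_def)
  then obtain x where "x \<in> nbhd b" "x \<notin> nbhd v"
    using exists_nbhd_diff[OF v_min assms(1)] assms(2) by (auto simp: nbhd_def)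
  then show False using assms by (auto simp: nbhd_def)
qed

lemma card_disjoint_neighbours_le_2:
  assumes I: "pairwise_disjoint I" "I \<subseteq> nbhd v"
  shows "card I \<le> 2"
proof (rule ccontr)
  assume "\<not> card I \<le> 2"
  then have "3 \<le> card I" by simp
  then obtain J where J: "J \<subseteq> I" "card J = 3"
    by (rule obtain_subset_with_card_n)
  obtain a b c where "J = {a, b, c}" and ne: "a \<noteq> b" "a \<noteq> c" "b \<noteq> c"
    using J(2) by (auto simp: card_3_iff)
  then have mem: "a \<in> I" "b \<in> I" "c \<in> I" using J(1) by auto
  have disj: "r a < l b \<or> r b < l a" "r a < l c \<or> r c < l a" "r b < l c \<or> r c < l b"
    using I(1) mem ne unfolding pairwise_disjoint_def by blast+
  have nb: "a \<in> nbhd v" "b \<in> nbhd v" "c \<in> nbhd v" using mem I(2) by auto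
  \<comment> \<open>However the disjunctions resolve, two of them form a chain: a tournament on
    three vertices has a Hamiltonian path.\<close>
  show False using disj nb no_three_disjoint_neighbours by blast
qed

lemma card_component_starts_two_neighbours:
  assumes a: "a \<in> nbhd v" and b: "b \<in> nbhd v" and ab: "r a < l b"
  shows "card (component_starts V) + 1 \<le> card (component_starts (V - nbhd v))"
proof -
  have V: "a \<in> V" "b \<in> V" using a b by (auto simp: nbhd_def)
  have "b \<notin> nbhd a" "a \<notin> nbhd b" using ab by (auto simp: nbhd_def)
  then obtain x y where "x \<in> nbhd a" "x \<notin> nbhd v" "y \<in> nbhd b" "y \<notin> nbhd v"
    using exists_nbhd_diff[OF v_min[OF V(1)] b] exists_nbhd_diff[OF v_min[OF V(2)] a] by blast
  then show ?thesis using card_component_starts_split[OF v a b ab] by blast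
qed

text \<open>The constant 3 is \<open>2 * 2 - 1\<close> when two elements of \<open>I\<close> are
  removed and a component is gained, and \<open>2 * 1 + 1\<close> when at most one is removed and at
  most one component is lost.\<close>

lemma potential_step:
  assumes I: "pairwise_disjoint I" "I \<subseteq> V"
  shows "2 * card I + card (component_starts V)
    \<le> 2 * card (I - nbhd v) + card (component_starts (V - nbhd v)) + 3"
proof -
  have "finite I" using I(2) finite_V by (rule finite_subset)
  then have card_I: "card I = card (I \<inter> nbhd v) + card (I - nbhd v)"
    by (metis card_Int_Diff)
  have disj: "pairwise_disjoint (I \<inter> nbhd v)"
    using I(1) by (auto simp: pairwise_disjoint_def)
  show ?thesis
  proof (cases "card (I \<inter> nbhd v) = 2")
    case True
    then obtain a b where ab: "I \<inter> nbhd v = {a, b}" "a \<noteq> b" by (auto simp: card_2_iff)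
    then have "a \<in> nbhd v" "b \<in> nbhd v" "r a < l b \<or> r b < l a"
      using disj by (auto simp: pairwise_disjoint_def)
    then show ?thesis
      using card_component_starts_two_neighbours card_I True by fastforce
  next
    case False
    then have "card (I \<inter> nbhd v) \<le> 1" using card_disjoint_neighbours_le_2[OF disj] by simp
    then show ?thesis using card_component_starts_remove[OF v] card_I by linarith
  qed
qed

end

end

section \<open>From graphs to interval families, and the bound for the algorithm\<close>

lemma (in digraph) card_closed_neighbourhood:
  "card (closed_neighbourhood G v) = out_degree G v + 1"
proof -
  have nbrs: "{u. v \<rightarrow>\<^bsub>G\<^esub> u} = head G ` out_arcs G v"
    by (auto simp: arcs_ends_conv)
  have "inj_on (head G) (out_arcs G v)"
    by (intro inj_onI no_multi_arcs) (auto simp: arc_to_ends_def)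
  then have "card {u. v \<rightarrow>\<^bsub>G\<^esub> u} = out_degree G v"
    by (simp add: nbrs card_image out_degree_def)
  moreover have "finite {u. v \<rightarrow>\<^bsub>G\<^esub> u}" by (simp add: nbrs finite_out_arcs)
  moreover have "v \<notin> {u. v \<rightarrow>\<^bsub>G\<^esub> u}" using adj_not_same by blast
  ultimately show ?thesis by (simp add: closed_neighbourhood_def)
qed

lemma dominates_induce_subgraph_iff:
  "u \<rightarrow>\<^bsub>G \<restriction> W\<^esub> v \<longleftrightarrow> u \<in> W \<and> v \<in> W \<and> u \<rightarrow>\<^bsub>G\<^esub> v"
  by (auto simp: arcs_ends_conv)

lemma greedy_subset_verts: "greedy G S \<Longrightarrow> S \<subseteq> verts G"
  by (induction rule: greedy.induct) auto

text \<open>The endpoints are parameters so that the same \<open>l\<close> and \<open>r\<close>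
  serve every induced subgraph that the algorithm reaches.\<close>

definition interval_representation ::
  "('a, 'b) pre_digraph \<Rightarrow> ('a \<Rightarrow> real) \<Rightarrow> ('a \<Rightarrow> real) \<Rightarrow> bool" where
  "interval_representation G l r \<longleftrightarrow> interval_family (verts G) l r \<and>
     (\<forall>u \<in> verts G. \<forall>v \<in> verts G. u \<noteq> v \<longrightarrow> (u \<rightarrow>\<^bsub>G\<^esub> v \<longleftrightarrow> l u \<le> r v \<and> l v \<le> r u))"

lemma (in digraph) closed_neighbourhood_eq_nbhd:
  assumes rep: "interval_representation G l r" and v: "v \<in> verts G"
  shows "closed_neighbourhood G v = interval_family.nbhd (verts G) l r v"
proof -
  interpret interval_family "verts G" l r
    using rep by (simp add: interval_representation_def)
  have "u \<in> closed_neighbourhood G v \<longleftrightarrow> u \<in> nbhd v" for u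
    using rep v l_le_r[OF v] adj_in_verts(2)[of v u]
    unfolding closed_neighbourhood_def nbhd_def interval_representation_def
    by (cases "u = v") auto
  then show ?thesis by blast
qed

text \<open>Each choice adds one to \<open>card S\<close> and so pays for the 3 in
  \<open>potential_step\<close>. \<open>I\<close> varies in the induction, which continues with
  \<open>I - nbhd v\<close> in the remaining graph.\<close>

lemma greedy_potential_bound:
  assumes "greedy G S" "digraph G" "interval_representation G l r" "independent_set G I"
  shows "2 * card I + card (interval_family.component_starts l r (verts G)) \<le> 3 * card S"
  using assms
proof (induction arbitrary: I rule: greedy.induct)
  case (greedy_empty G)
  interpret interval_family "verts G" l r
    using greedy_empty.prems(2) by (simp add: interval_representation_def)
  show ?case
    using greedy_empty by (auto simp: independent_set_def component_starts_def)
next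
  case (greedy_step v G S)
  interpret digraph G by fact
  interpret interval_family "verts G" l r
    using greedy_step.prems(2) by (simp add: interval_representation_def)
  let ?H = "G \<restriction> (verts G - closed_neighbourhood G v)"
  have nbhd: "closed_neighbourhood G u = nbhd u" if "u \<in> verts G" for u
    using closed_neighbourhood_eq_nbhd[OF greedy_step.prems(2) that] .
  have v_min: "card (nbhd v) \<le> card (nbhd u)" if u: "u \<in> verts G" for u
  proof -
    have "out_degree G v \<le> out_degree G u"
      using u greedy_step.hyps(2) by (simp add: min_degree_def)
    then show ?thesis
      using card_closed_neighbourhood[of u] card_closed_neighbourhood[of v] nbhd u greedy_step.hyps(1)
      by simp
  qed
  have I: "I \<subseteq> verts G" "pairwise_disjoint I"
    using greedy_step.prems(2,3)
    unfolding independent_set_def pairwise_disjoint_def interval_representation_def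
    by (blast, meson in_mono not_le)
  have "digraph ?H" by (rule digraph_subgraph) (auto intro: induced_imp_subgraph)
  moreover have "interval_representation ?H l r"
    using greedy_step.prems(2) finite_V l_le_r
    by (auto simp: interval_representation_def interval_family_def dominates_induce_subgraph_iff)
  moreover have "independent_set ?H (I - nbhd v)"
    using greedy_step.prems(3) nbhd[OF greedy_step.hyps(1)]
    by (auto simp: independent_set_def dominates_induce_subgraph_iff)
  ultimately have
    "2 * card (I - nbhd v) + card (component_starts (verts G - nbhd v)) \<le> 3 * card S"
    using greedy_step.IH nbhd[OF greedy_step.hyps(1)] by fastforce
  moreover have "card (insert v S) = card S + 1"
  proof -
    have "S \<subseteq> verts G - closed_neighbourhood G v"
      using greedy_subset_verts[OF greedy_step.hyps(3)] by simp
    then have "v \<notin> S" "finite S"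
      using finite_subset[OF _ finite_V] by (auto simp: closed_neighbourhood_def)
    then show ?thesis by simp
  qed
  ultimately show ?case
    using potential_step[OF greedy_step.hyps(1) v_min I(2,1)] by simp
qed

theorem theorem2:
  fixes G :: "('a, 'b) pre_digraph" and I S :: "'a set"
  assumes "interval_graph G"
    and "maximum_independent_set G I"
    and "greedy G S"
  shows "real (card S) \<ge> 2 / 3 * real (card I)"
proof -
  obtain l r :: "'a \<Rightarrow> real" where G: "graph G"
    and lr: "\<forall>v \<in> verts G. l v \<le> r v"
    and adj: "\<forall>u \<in> verts G. \<forall>v \<in> verts G. u \<noteq> v \<longrightarrow>
      (u \<rightarrow>\<^bsub>G\<^esub> v \<longleftrightarrow> {l u..r u} \<inter> {l v..r v} \<noteq> {})"
    using assms(1) unfolding interval_graph_def by blast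
  interpret graph G by fact
  have "{l u..r u} \<inter> {l v..r v} \<noteq> {} \<longleftrightarrow> l u \<le> r v \<and> l v \<le> r u"
    if "u \<in> verts G" "v \<in> verts G" for u v
    using lr that by (auto simp: Int_atLeastAtMost)
  then have "interval_representation G l r"
    using lr adj by (auto simp: interval_representation_def interval_family_def)
  moreover have "independent_set G I"
    using assms(2) by (simp add: maximum_independent_set_def)
  ultimately have "2 * card I \<le> 3 * card S"
    using greedy_potential_bound[OF assms(3) digraph_axioms] by fastforce
  then show ?thesis by linarith
qed

end
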